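(* Let $(F_n)_{n\in\mathbb{N}_0}$ be the Fibonacci numbers, defined by $F_0=1$, $F_1=1$ and $F_n=F_{n-1}+F_{n-2}$ for every integer $n\geq 2$. Then $h(\{F_n \colon n \in \mathbb{N}_0\}^2) = \infty$.
   Context: $\mathbb{N}_0=\{0,1,2,\dots\}$. For a discrete set $S\subseteq\mathbb{R}^2$, a convex polygon $P$ with all vertices in $S$ is empty in $S$ if $P$ (including its boundary, in particular the interiors of its edges) contains no points of $S$ other than its vertices. $h(S)$ denotes the maximum number of vertices of an empty polygon in $S$, with $h(S)=\infty$ if there are empty polygons in $S$ with arbitrarily many vertices. For $A\subseteq\mathbb{R}$, $A^2=A\times A$. *)

theory Defs
  imports "HOL-Analysis.Analysis" "HOL-Library.Extended_Nat"
begin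

type_synonym point = "real \<times> real"

definition vertices :: "point set \<Rightarrow> point set" where
  "vertices P = {v. v extreme_point_of P}"

text \<open>Nonempty interior excludes the degenerate cases (empty set, point, segment).\<close>

definition convex_polygon :: "point set \<Rightarrow> bool" where
  "convex_polygon P \<longleftrightarrow> polytope P \<and> interior P \<noteq> {}"

definition empty_polygon_in :: "point set \<Rightarrow> point set \<Rightarrow> bool" where
  "empty_polygon_in S P \<longleftrightarrow> convex_polygon P \<and> vertices P \<subseteq> S \<and> P \<inter> S \<subseteq> vertices P"

text \<open>
  The supremum in \<^typ>\<open>enat\<close> is the maximum when the numbers of vertices are bounded
  and \<open>\<infinity>\<close> otherwise; it is \<open>0\<close> if \<open>S\<close> contains no empty polygon.  A polytope has
  finitely many extreme points, so \<^const>\<open>card\<close> counts the vertices.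
\<close>

definition h :: "point set \<Rightarrow> enat" where
  "h S = (SUP P \<in> {P. empty_polygon_in S P}. enat (card (vertices P)))"

end

theory Submission
  imports Defs "HOL-Number_Theory.Fib"
begin

text \<open>
  The points \<open>(F\<^sub>n, F\<^sub>n\<^sub>+\<^sub>1)\<close> lie alternately on the two branches \<open>y\<^sup>2 - x y - x\<^sup>2 = \<plusminus>1\<close> of
  a pair of hyperbolas with common asymptote \<open>y = \<phi> x\<close>.  Points of a single branch are in convex
  position, and their hull stays strictly between the lines \<open>y = \<phi> x\<close> and \<open>y = 2 x\<close>.  A point
  \<open>(F\<^sub>a, F\<^sub>b)\<close> in this sector has \<open>b = a + 1\<close> and lies on the same branch, so that the hull of
  consecutive points of the branch is empty.
\<close>

text \<open>The conjugate root of \<open>x\<^sup>2 = x + 1\<close> is written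
  \<open>1 - golden\<close> throughout; it equals \<open>- 1 / golden\<close>.\<close>

definition golden :: real where
  "golden = (1 + sqrt 5) / 2"

lemma golden_gt_1: "golden > 1"
  by (simp add: golden_def)

lemma golden_square: "golden * golden = golden + 1"
  by (simp add: golden_def field_simps)

lemma conj_golden_neg: "1 - golden < 0"
  using golden_gt_1 by simp

lemma golden_mult_conj: "golden * (1 - golden) = - 1"
  using golden_square by (simp add: algebra_simps)

text \<open>Subtracting \<open>golden\<close> times the preceding term cancels the
  \<open>golden\<close> part of the recurrence and leaves a geometric sequence. Its alternating sign
  tells on which side of the asymptote a point lies.\<close>

lemma fib_Suc_minus_golden:
  "real (fib (Suc n)) - golden * real (fib n) = (1 - golden) ^ n"
proof (induction n)
  case (Suc n)
  have "real (fib (Suc (Suc n))) - golden * real (fib (Suc n))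
      = (1 - golden) * (real (fib (Suc n)) - golden * real (fib n))"
    using golden_square by (simp add: algebra_simps) (simp add: mult.assoc[symmetric] algebra_simps)
  then show ?case using Suc by simp
qed simp

lemma fib_Suc_minus_conj_golden:
  "real (fib (Suc n)) - (1 - golden) * real (fib n) = golden ^ n"
proof (induction n)
  case (Suc n)
  have "real (fib (Suc (Suc n))) - (1 - golden) * real (fib (Suc n))
      = golden * (real (fib (Suc n)) - (1 - golden) * real (fib n))"
    using golden_square by (simp add: algebra_simps) (simp add: mult.assoc[symmetric] algebra_simps)
  then show ?case using Suc by simp
qed simp

text \<open>Since \<open>fib 0 = 0\<close>, even first indices give
  \<open>y - golden * x > 0\<close>, the branch with constant \<open>+ 1\<close> above the
  asymptote.\<close>

definition branch_point :: "nat \<Rightarrow> point" where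
  "branch_point k = (real (fib (2 * k)), real (fib (Suc (2 * k))))"

text \<open>
  With \<open>u = y - \<phi> x\<close> and \<open>v = y - (1 - \<phi>) x\<close> the branch is \<open>u v = 1\<close>, and the form is
  \<open>v\<^sub>k u + u\<^sub>k v\<close>.  On the branch it equals \<open>t + 1 / t\<close> for some \<open>t > 0\<close>, with its minimum
  only at the \<open>k\<close>-th point.
\<close>

definition tangent_form :: "nat \<Rightarrow> point" where
  "tangent_form k = (- (golden ^ (2 * k + 1)) - (1 - golden) ^ (2 * k + 1),
    golden ^ (2 * k) + (1 - golden) ^ (2 * k))"

lemma tangent_form_branch_point:
  "tangent_form k \<bullet> branch_point j
    = golden ^ (2 * k) * (1 - golden) ^ (2 * j) + (1 - golden) ^ (2 * k) * golden ^ (2 * j)"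
  unfolding fib_Suc_minus_golden[symmetric, of "2 * j"]
    fib_Suc_minus_conj_golden[symmetric, of "2 * j"]
  by (simp add: tangent_form_def branch_point_def algebra_simps)

lemma golden_power_mult_conj:
  "golden ^ (2 * k) * (1 - golden) ^ (2 * k) = 1"
  by (simp add: power_mult_distrib[symmetric] golden_mult_conj)

text \<open>The coordinate \<open>v = golden ^ (2 * k)\<close> alone recovers \<open>k\<close>.
  Injectivity turns the number of indices into the number of vertices.\<close>

lemma inj_branch_point: "inj branch_point"
proof (rule injI)
  fix i j assume "branch_point i = branch_point j"
  then have "golden ^ (2 * i) = golden ^ (2 * j)"
    unfolding fib_Suc_minus_conj_golden[symmetric] by (simp add: branch_point_def)
  then show "i = j"
    using golden_gt_1 power_inject_exp by fastforce
qed

lemma tangent_form_branch_point_gt: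
  assumes "j \<noteq> k"
  shows "tangent_form k \<bullet> branch_point j > tangent_form k \<bullet> branch_point k"
proof -
  define a b where "a = golden ^ (2 * k)" and "b = golden ^ (2 * j)"
  have "a \<noteq> b"
    using assms golden_gt_1 power_inject_exp[of golden "2 * k" "2 * j"] by (auto simp: a_def b_def)
  have pos: "a > 0" "b > 0" using golden_gt_1 by (auto simp: a_def b_def)
  have "(1 - golden) ^ (2 * k) = 1 / a" "(1 - golden) ^ (2 * j) = 1 / b"
    using pos golden_power_mult_conj[of k] golden_power_mult_conj[of j]
    unfolding a_def b_def by (metis less_irrefl mult.commute nonzero_eq_divide_eq)+
  then have "tangent_form k \<bullet> branch_point j = a / b + b / a"
      "tangent_form k \<bullet> branch_point k = 2"
    using pos by (simp_all add: tangent_form_branch_point flip: a_def b_def)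
  moreover have "a / b + b / a - 2 = (a - b)\<^sup>2 / (a * b)"
    using pos by (simp add: field_simps power2_eq_square)
  moreover have "(a - b)\<^sup>2 / (a * b) > 0"
    using pos \<open>a \<noteq> b\<close> by simp
  ultimately show ?thesis by simp
qed

text \<open>\<open>tangent_form k\<close> strictly separates the \<open>k\<close>-th point from the
  others, hence from their hull, so adding that point back makes it extreme.\<close>

lemma vertices_hull_branch_points:
  assumes "finite K"
  shows "vertices (convex hull (branch_point ` K)) = branch_point ` K"
proof
  show "vertices (convex hull (branch_point ` K)) \<subseteq> branch_point ` K"
    using extreme_point_of_convex_hull by (auto simp: vertices_def)
  show "branch_point ` K \<subseteq> vertices (convex hull (branch_point ` K))"
  proof (rule image_subsetI)
    fix k assume k: "k \<in> K"
    let ?H = "{z. tangent_form k \<bullet> z > tangent_form k \<bullet> branch_point k}"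
    have "convex hull (branch_point ` (K - {k})) \<subseteq> ?H"
      using tangent_form_branch_point_gt by (intro hull_minimal convex_halfspace_gt) auto
    then have "branch_point k \<notin> convex hull (branch_point ` (K - {k}))"
      by blast
    then have "branch_point k extreme_point_of
        (convex hull (insert (branch_point k) (branch_point ` (K - {k}))))"
      using assms by (intro extreme_point_of_convex_hull_insert) auto
    moreover have "insert (branch_point k) (branch_point ` (K - {k})) = branch_point ` K"
      using k by auto
    ultimately show "branch_point k \<in> vertices (convex hull (branch_point ` K))"
      by (simp add: vertices_def)
  qed
qed

lemma interior_hull_branch_points:
  assumes "{2, 3, 4} \<subseteq> K"
  shows "interior (convex hull (branch_point ` K)) \<noteq> {}"
proof
  assume "interior (convex hull (branch_point ` K)) = {}"
  then obtain a b where a: "a \<noteq> 0" "convex hull (branch_point ` K) \<subseteq> {x. a \<bullet> x = b}"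
    using empty_interior_subset_hyperplane convex_convex_hull by metis
  have "a \<bullet> branch_point k = b" if "k \<in> K" for k
    using a(2) that by (meson hull_inc image_eqI mem_Collect_eq subsetD)
  then have "a \<bullet> branch_point 2 = b" "a \<bullet> branch_point 3 = b" "a \<bullet> branch_point 4 = b"
    using assms by auto
  moreover have "branch_point 2 = (3, 5)" "branch_point 3 = (8, 13)" "branch_point 4 = (21, 34)"
    by (simp_all add: branch_point_def numeral_eq_Suc)
  \<comment> \<open>The differences \<open>(5, 8)\<close> and \<open>(13, 21)\<close> have
    determinant 1, so only the zero vector is orthogonal to both.\<close>
  ultimately have "fst a = 0" "snd a = 0"
    by (simp_all add: inner_prod_def)
  then show False using a(1) by (simp add: prod_eq_iff)
qed

lemma fib_less_fib_Suc:
  assumes "n \<ge> 2"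
  shows "fib n < fib (Suc n)"
proof -
  have "fib (Suc n) = fib n + fib (n - 1)"
    using assms by (cases n) auto
  then show ?thesis using assms fib_neq_0_nat[of "n - 1"] by simp
qed

text \<open>Half-planes are convex, so these bounds pass to the hull. The first two cut out the
  sector; the last two keep the index between 2 and \<open>m\<close>.\<close>

lemma branch_point_bounds:
  assumes "2 \<le> k" "k \<le> m"
  shows "branch_point k \<in> {z. (- golden, 1) \<bullet> z > 0} \<inter> {z. (2, - 1) \<bullet> z > 0}
    \<inter> {z. (1, 0) \<bullet> z \<ge> 3} \<inter> {z. (1, 0) \<bullet> z \<le> real (fib (2 * m))}"
proof -
  have "real (fib (Suc (2 * k))) - golden * real (fib (2 * k)) > 0"
    unfolding fib_Suc_minus_golden using conj_golden_neg by (simp add: zero_less_power_eq)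
  moreover have "fib (Suc (2 * k)) < 2 * fib (2 * k)"
  proof -
    \<comment> \<open>The claim reduces to \<open>fib n < fib (Suc n)\<close>. At
      \<open>k = 1\<close> it fails: \<open>(1, 2)\<close> lies on \<open>y = 2 x\<close>.\<close>
    obtain n where n: "2 * k = Suc n" "n \<ge> 2"
      using assms(1) by (cases "2 * k") auto
    then show ?thesis using fib_less_fib_Suc[of n] by simp
  qed
  moreover have "fib 4 \<le> fib (2 * k)" "fib (2 * k) \<le> fib (2 * m)"
    using assms by (auto intro!: fib_mono)
  moreover have "fib 4 = 3" by (simp add: numeral_eq_Suc)
  ultimately show ?thesis
    by (simp add: branch_point_def)
qed

text \<open>For \<open>b \<le> a\<close> the point is not above the asymptote, and
  \<open>b \<ge> a + 2\<close> forces \<open>y \<ge> 2 x\<close>. The parity is read off the sign of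
  \<open>(1 - golden) ^ a\<close>.\<close>

lemma fib_point_in_sector:
  assumes "golden * real (fib a) < real (fib b)" "fib b < 2 * fib a"
  shows "b = Suc a" "even a"
proof -
  show b: "b = Suc a"
  proof (rule ccontr)
    assume "b \<noteq> Suc a"
    then consider "b \<le> a" | "b \<ge> Suc (Suc a)" by linarith
    then show False
    proof cases
      case 1
      then have "real (fib b) \<le> 1 * real (fib a)" by (simp add: fib_mono)
      also have "\<dots> \<le> golden * real (fib a)"
        using golden_gt_1 by (intro mult_right_mono) auto
      finally show False using assms(1) by simp
    next
      case 2
      have "2 * fib a \<le> fib (Suc (Suc a))"
        using fib_mono[of a "Suc a"] by simp
      also have "\<dots> \<le> fib b" using 2 by (rule fib_mono)
      finally show False using assms(2) by simp
    qed
  qed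
  have "(1 - golden) ^ a > 0"
    using assms(1) fib_Suc_minus_golden[of a] by (simp add: b)
  then show "even a"
    using conj_golden_neg by (cases "a = 0") (simp_all add: zero_less_power_eq)
qed

lemma empty_polygon_hull_branch_points:
  assumes S: "S = range (\<lambda>n. real (fib (Suc n)))" and m: "m \<ge> 4"
  shows "empty_polygon_in (S \<times> S) (convex hull (branch_point ` {2..m}))"
proof -
  let ?P = "convex hull (branch_point ` {2..m})"
  \<comment> \<open>The index shift in \<open>S\<close> drops only \<open>fib 0 = 0\<close>.\<close>
  have fib_in: "real (fib n) \<in> S" if "n > 0" for n
    using that by (cases n) (auto simp: S)
  have "branch_point ` {2..m} \<subseteq> S \<times> S"
    by (auto simp: branch_point_def simp del: fib.simps intro!: fib_in)
  moreover have "?P \<inter> (S \<times> S) \<subseteq> branch_point ` {2..m}"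
  proof
    fix z assume z: "z \<in> ?P \<inter> (S \<times> S)"
    then obtain a b where ab: "z = (real (fib a), real (fib b))"
      by (auto simp: S)
    have "?P \<subseteq> {z. (- golden, 1) \<bullet> z > 0} \<inter> {z. (2, - 1) \<bullet> z > 0}
        \<inter> {z. (1, 0) \<bullet> z \<ge> 3} \<inter> {z. (1, 0) \<bullet> z \<le> real (fib (2 * m))}"
    proof (rule hull_minimal)
      show "branch_point ` {2..m} \<subseteq> {z. (- golden, 1) \<bullet> z > 0} \<inter> {z. (2, - 1) \<bullet> z > 0}
          \<inter> {z. (1, 0) \<bullet> z \<ge> 3} \<inter> {z. (1, 0) \<bullet> z \<le> real (fib (2 * m))}"
        using branch_point_bounds by (meson atLeastAtMost_iff image_subsetI)
    qed (intro convex_Int convex_halfspace_gt convex_halfspace_ge convex_halfspace_le)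
    then have bounds: "golden * real (fib a) < real (fib b)" "fib b < 2 * fib a"
        "3 \<le> fib a" "fib a \<le> fib (2 * m)"
      using z by (auto simp: ab)
    obtain k where k: "a = 2 * k" "b = Suc (2 * k)"
      using fib_point_in_sector[OF bounds(1,2)] by (auto elim: evenE)
    have "k \<ge> 2"
    proof (rule ccontr)
      assume "\<not> k \<ge> 2"
      then have "fib a \<le> fib 2" by (intro fib_mono) (simp add: k)
      then show False using bounds(3) by (simp add: numeral_eq_Suc)
    qed
    moreover have "k \<le> m"
    proof (rule ccontr)
      assume "\<not> k \<le> m"
      then have "fib (Suc (2 * m)) \<le> fib a" by (intro fib_mono) (simp add: k)
      then show False using bounds(4) fib_less_fib_Suc[of "2 * m"] m by simp
    qed
    ultimately show "z \<in> branch_point ` {2..m}"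
      by (auto simp: ab k branch_point_def)
  qed
  moreover have "polytope ?P"
    by (intro polytope_convex_hull) simp
  moreover have "interior ?P \<noteq> {}"
    using m by (intro interior_hull_branch_points) auto
  ultimately show ?thesis
    by (auto simp: empty_polygon_in_def convex_polygon_def vertices_hull_branch_points)
qed

lemma fib_recurrence_unique:
  fixes F :: "nat \<Rightarrow> real"
  assumes "F 0 = 1" "F 1 = 1" "\<And>n. n \<ge> 2 \<Longrightarrow> F n = F (n - 1) + F (n - 2)"
  shows "F n = real (fib (Suc n))"
proof (induction n rule: less_induct)
  case (less n)
  show ?case
  proof (cases "n \<ge> 2")
    case True
    then obtain k where "n = Suc (Suc k)" by (metis add_2_eq_Suc le_Suc_ex)
    then show ?thesis using assms(3)[of n] less by simp
  next
    case False
    then have "n = 0 \<or> n = 1" by auto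
    then show ?thesis using assms(1,2) by auto
  qed
qed

theorem proposition5:
  fixes F :: "nat \<Rightarrow> real"
  assumes "F 0 = 1" and "F 1 = 1"
    and "\<And>n. n \<ge> 2 \<Longrightarrow> F n = F (n - 1) + F (n - 2)"
  shows "h (range F \<times> range F) = \<infinity>"
proof -
  have "F = (\<lambda>n. real (fib (Suc n)))"
    using fib_recurrence_unique[OF assms] by blast
  then have S: "range F = range (\<lambda>n. real (fib (Suc n)))" by simp
  have "enat n \<le> h (range F \<times> range F)" for n
  proof -
    \<comment> \<open>The offset 4 keeps the indices 2, 3, 4 present even for \<open>n = 0\<close>,
      which gives the hull nonempty interior.\<close>
    let ?P = "convex hull (branch_point ` {2..n + 4})"
    have "card (vertices ?P) = n + 3"
      by (simp add: vertices_hull_branch_points card_image inj_on_subset[OF inj_branch_point])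
    then have "enat n \<le> enat (card (vertices ?P))" by simp
    also have "\<dots> \<le> h (range F \<times> range F)"
      unfolding h_def using empty_polygon_hull_branch_points[OF S, of "n + 4"]
      by (intro SUP_upper) simp
    finally show ?thesis .
  qed
  then show ?thesis
    by (metis enat_ord_simps(1) not_enat_eq not_less_eq_eq order_refl)
qed

end
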